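(* Let $X^{\mathrm{in}}\subset\mathbb R^d$ be a nonempty polytope with $X^{\mathrm{in}}\neq\{0\}$, let $A$ be a real $d\times d$ matrix with spectral radius $\rho(A)<1$ admitting a decomposition $A=UDU^{-1}$ with $U$ a non-singular complex matrix and $D$ a complex diagonal matrix, let $Q$ be a real symmetric $d\times d$ matrix with $\lambda_{\max}(Q)\neq 0$ that is either positive semi-definite or negative definite, and let $q\in\mathbb R^d$, with $q\neq0$ if $Q$ is negative definite. Let $\nu_k$ and $\mathbf K^{\rm diag}_\nu$ be as defined in the context, and let $N\in\mathbb N$. If $\inf\{k\in\mathbb N\mid\nu_k>0\}\le N$, then the sequence $\left(\mathbf K^{\rm diag}_\nu(k)\right)_{k\in\Gamma}$ is decreasing (in the weak sense: $j,k\in\Gamma$ and $j<k$ imply $\mathbf K^{\rm diag}_\nu(k)\le\mathbf K^{\rm diag}_\nu(j)$), where $\Gamma$ is the set of integers $k\in\mathbb N$ such that $\nu_k>0$ and $\nu_k>\nu_j$ for all $j<k$.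
   Context: $\mathbb N=\{0,1,2,\dots\}$. A polytope is the convex hull of finitely many points. $U^*$ is the conjugate transpose; $\lambda_{\max}(B)$ is the greatest eigenvalue of a Hermitian matrix $B$. For $k\in\mathbb N$, $\nu_k=\sup_{x\in X^{\mathrm{in}}}\left(x^\intercal (A^k)^\intercal QA^kx+q^\intercal A^kx\right)$. For a Hermitian matrix $B$, $\mu(B)=\sup_{x\in X^{\mathrm{in}}}x^\intercal Bx$. $V_{\rm diag}=\dfrac{\|U^*q\|_2}{2\sqrt{|\lambda_{\max}(U^*QU)|}}$ (here $\lambda_{\max}(U^*QU)\neq0$ because $\lambda_{\max}(Q)\neq0$). For $j$ with $\nu_j>0$, $$\mathbf K^{\rm diag}_\nu(j)=\left\lfloor\frac{\ln\left(\left(\sqrt{\nu_j+V_{\rm diag}^2}-V_{\rm diag}\right)\left(\sqrt{|\lambda_{\max}(U^*QU)|\,\mu\left((UU^* )^{-1}\right)}\right)^{-1}\right)}{\ln(\rho(A))}\right\rfloor+1 ,$$ with, in the degenerate case $\rho(A)=0$, the convention $\ln 0=-\infty$ and $c/(-\infty)=0$ for real $c$, so that $\mathbf K^{\rm diag}_\nu(j)=1$. The integers $\mathbf K^{\rm diag}_\nu(k)$, $k\in\Gamma$, are the successive iteration bounds recomputed by the paper's algorithm, which scans $\nu_0,\nu_1,\dots$ (searching for a first positive term up to rank $N$) and replaces its bound by $\mathbf K^{\rm diag}_\nu(k)$ each time the current best value is strictly improved at rank $k$. *)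

theory Defs
  imports "HOL-Analysis.Analysis" "HOL-Library.Extended_Nat"
begin

definition cvec :: "real ^ 'n \<Rightarrow> complex ^ 'n" where
  "cvec x = (\<chi> i. complex_of_real (x $ i))"

definition cmat :: "real ^ 'n ^ 'm \<Rightarrow> complex ^ 'n ^ 'm" where
  "cmat A = map_matrix complex_of_real A"

definition ctranspose :: "complex ^ 'n ^ 'm \<Rightarrow> complex ^ 'm ^ 'n" where
  "ctranspose U = map_matrix cnj (transpose U)"

definition diagonal_matrix :: "complex ^ 'n ^ 'n \<Rightarrow> bool" where
  "diagonal_matrix D \<longleftrightarrow> (\<forall>i j. i \<noteq> j \<longrightarrow> D $ i $ j = 0)"

text \<open>The library's power on square matrices is componentwise, because multiplication
  on the type of vectors is.  This is the power for the matrix product.\<close>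

primrec matpow :: "real ^ 'n ^ 'n \<Rightarrow> nat \<Rightarrow> real ^ 'n ^ 'n" where
  "matpow A 0 = mat 1"
| "matpow A (Suc k) = A ** matpow A k"

definition eigenvalues :: "complex ^ 'n ^ 'n \<Rightarrow> complex set" where
  "eigenvalues B = {l. \<exists>v. v \<noteq> 0 \<and> B *v v = l *s v}"

definition spectral_radius :: "real ^ 'n ^ 'n \<Rightarrow> real" where
  "spectral_radius A = Max (cmod ` eigenvalues (cmat A))"

text \<open>Only used for Hermitian matrices, all of whose eigenvalues are real.\<close>

definition lambda_max :: "complex ^ 'n ^ 'n \<Rightarrow> real" where
  "lambda_max B = Max {l. complex_of_real l \<in> eigenvalues B}"

definition pos_semidefinite :: "real ^ 'n ^ 'n \<Rightarrow> bool" where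
  "pos_semidefinite Q \<longleftrightarrow> (\<forall>x. 0 \<le> x \<bullet> (Q *v x))"

definition neg_definite :: "real ^ 'n ^ 'n \<Rightarrow> bool" where
  "neg_definite Q \<longleftrightarrow> (\<forall>x. x \<noteq> 0 \<longrightarrow> x \<bullet> (Q *v x) < 0)"

definition nu :: "(real ^ 'n) set \<Rightarrow> real ^ 'n ^ 'n \<Rightarrow> real ^ 'n ^ 'n \<Rightarrow> real ^ 'n \<Rightarrow> nat \<Rightarrow> real" where
  "nu X A Q q k =
     (SUP x\<in>X. x \<bullet> ((transpose (matpow A k) ** Q ** matpow A k) *v x) + q \<bullet> (matpow A k *v x))"

text \<open>For real \<open>x\<close> and Hermitian \<open>B\<close> the value of the quadratic form is real;
  \<open>Re\<close> only changes the type.\<close>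

definition mu :: "(real ^ 'n) set \<Rightarrow> complex ^ 'n ^ 'n \<Rightarrow> real" where
  "mu X B = (SUP x\<in>X. Re (\<Sum>i\<in>UNIV. cvec x $ i * (B *v cvec x) $ i))"

definition V_diag :: "complex ^ 'n ^ 'n \<Rightarrow> real ^ 'n ^ 'n \<Rightarrow> real ^ 'n \<Rightarrow> real" where
  "V_diag U Q q =
     norm (ctranspose U *v cvec q) / (2 * sqrt \<bar>lambda_max (ctranspose U ** cmat Q ** U)\<bar>)"

definition K_diag ::
  "(real ^ 'n) set \<Rightarrow> real ^ 'n ^ 'n \<Rightarrow> real ^ 'n ^ 'n \<Rightarrow> real ^ 'n \<Rightarrow> complex ^ 'n ^ 'n \<Rightarrow> nat \<Rightarrow> int" where
  "K_diag X A Q q U j =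
     (if spectral_radius A = 0 then 1
      else \<lfloor>ln ((sqrt (nu X A Q q j + (V_diag U Q q)\<^sup>2) - V_diag U Q q)
                / sqrt (\<bar>lambda_max (ctranspose U ** cmat Q ** U)\<bar>
                        * mu X (matrix_inv (U ** ctranspose U))))
              / ln (spectral_radius A)\<rfloor> + 1)"

definition Gamma_set :: "(real ^ 'n) set \<Rightarrow> real ^ 'n ^ 'n \<Rightarrow> real ^ 'n ^ 'n \<Rightarrow> real ^ 'n \<Rightarrow> nat set" where
  "Gamma_set X A Q q = {k. nu X A Q q k > 0 \<and> (\<forall>j<k. nu X A Q q j < nu X A Q q k)}"

end

theory Submission
  imports Defs
begin

text \<open>The index \<open>k\<close> enters the bound only through \<open>\<nu>\<^sub>k\<close>, and
  \<open>t \<mapsto> sqrt (t + V\<^sup>2) - V\<close> is increasing and, because \<open>V \<ge> 0\<close>, positive for \<open>t > 0\<close>.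
  Dividing by the common scale shifts the logarithm by a constant, so the numerator
  \<open>ln (\<dots>)\<close> is nondecreasing in \<open>\<nu>\<^sub>k\<close>.  The denominator \<open>ln (\<rho>(A))\<close> is negative as soon as
  \<open>0 < \<rho>(A) < 1\<close>, hence the quotient, and with it its floor, is nonincreasing in \<open>\<nu>\<^sub>k\<close>
  (lemma \<open>floor_ln_ratio_antimono\<close>).  By the definition of \<open>\<Gamma>\<close>, \<open>j < k\<close> in \<open>\<Gamma>\<close> forces
  \<open>0 < \<nu>\<^sub>j < \<nu>\<^sub>k\<close>, which gives the claim; when \<open>\<rho>(A) = 0\<close> the bounds
  are all \<open>1\<close>.

  The spectral radius is a maximum of moduli, and it is nonnegative only because this maximum
  ranges over a finite nonempty set.  Both facts are read off from \<open>A = U D U\<^sup>-\<^sup>1\<close>: the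
  eigenvalues of \<open>A\<close> are exactly the diagonal entries of \<open>D\<close>
  (lemma \<open>eigenvalues_diagonalization\<close>).\<close>

lemma diagonal_matrix_mult_vector:
  assumes "diagonal_matrix D"
  shows "(D *v w) $ i = D $ i $ i * w $ i"
proof -
  have "(D *v w) $ i = (\<Sum>j\<in>UNIV. if j = i then D $ i $ i * w $ i else 0)"
    unfolding matrix_vector_mult_def vec_lambda_beta
    by (rule sum.cong) (use assms in \<open>auto simp: diagonal_matrix_def\<close>)
  then show ?thesis by simp
qed

lemma eigenvalues_diagonal_matrix:
  assumes "diagonal_matrix D"
  shows "eigenvalues D = range (\<lambda>i. D $ i $ i)"
proof (intro equalityI subsetI)
  fix l assume "l \<in> eigenvalues D"
  then obtain w where "w \<noteq> 0" and w: "D *v w = l *s w"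
    by (auto simp: eigenvalues_def)
  then obtain i where i: "w $ i \<noteq> 0" by (auto simp: vec_eq_iff)
  have "D $ i $ i * w $ i = l * w $ i"
    using arg_cong[OF w, of "\<lambda>v. v $ i"] assms by (simp add: diagonal_matrix_mult_vector)
  with i have "D $ i $ i = l" by simp
  then show "l \<in> range (\<lambda>i. D $ i $ i)" by blast
next
  fix l assume "l \<in> range (\<lambda>i. D $ i $ i)"
  then obtain i where l: "l = D $ i $ i" by blast
  have "D *v axis i 1 = l *s axis i 1"
    using assms by (auto simp: vec_eq_iff diagonal_matrix_mult_vector l axis_def)
  moreover have "axis i (1::complex) \<noteq> 0" by simp
  ultimately show "l \<in> eigenvalues D" unfolding eigenvalues_def by blast
qed

text \<open>An eigenvector of \<open>C\<close> is carried to one of \<open>P C P'\<close> by \<open>P\<close>; the left inverse \<open>P'\<close> keeps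
  it nonzero.  Applied to \<open>P\<close> and to its inverse, this gives both inclusions between the spectra
  of similar matrices.\<close>

lemma eigenvalues_similar_subset:
  assumes "P' ** P = mat 1"
  shows "eigenvalues C \<subseteq> eigenvalues (P ** C ** P')"
proof
  fix l assume "l \<in> eigenvalues C"
  then obtain v where v: "v \<noteq> 0" "C *v v = l *s v" by (auto simp: eigenvalues_def)
  have recover: "P' *v (P *v v) = v" by (simp add: matrix_vector_mul_assoc assms)
  have "P *v v \<noteq> 0" using recover v(1) by auto
  moreover have "(P ** C ** P') *v (P *v v) = l *s (P *v v)"
    by (simp only: matrix_vector_mul_assoc[symmetric] recover v(2) vector_scalar_commute)
  ultimately show "l \<in> eigenvalues (P ** C ** P')" unfolding eigenvalues_def by blast
qed

lemma eigenvalues_diagonalization: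
  assumes "invertible U" and "diagonal_matrix D" and B: "B = U ** D ** matrix_inv U"
  shows "eigenvalues B = range (\<lambda>i. D $ i $ i)"
proof -
  have inv: "U ** matrix_inv U = mat 1" "matrix_inv U ** U = mat 1"
    using someI_ex[OF assms(1)[unfolded invertible_def]] by (simp_all add: matrix_inv_def)
  have "matrix_inv U ** B ** U = (matrix_inv U ** U) ** D ** (matrix_inv U ** U)"
    by (simp only: B matrix_mul_assoc)
  then have D: "matrix_inv U ** B ** U = D" by (simp add: inv)
  have "eigenvalues D \<subseteq> eigenvalues B"
    unfolding B by (rule eigenvalues_similar_subset[OF inv(2)])
  moreover have "eigenvalues B \<subseteq> eigenvalues D"
    using eigenvalues_similar_subset[OF inv(1), of B] by (simp only: D)
  ultimately show ?thesis using eigenvalues_diagonal_matrix[OF assms(2)] by simp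
qed

lemma spectral_radius_nonneg:
  assumes "finite (eigenvalues (cmat A))" and "eigenvalues (cmat A) \<noteq> {}"
  shows "0 \<le> spectral_radius A"
proof -
  have "spectral_radius A \<in> cmod ` eigenvalues (cmat A)"
    unfolding spectral_radius_def using assms by (intro Max_in) auto
  then show ?thesis by auto
qed

lemma sqrt_shift_pos:
  fixes V t :: real
  assumes "0 \<le> V" and "0 < t"
  shows "0 < sqrt (t + V\<^sup>2) - V"
  using assms real_less_rsqrt[of V "t + V\<^sup>2"] by simp

text \<open>For a nonzero scale \<open>c\<close>, of either sign, \<open>ln (a / c) = ln a - ln c\<close>, because the total
  logarithm satisfies \<open>ln x = ln \<bar>x\<bar>\<close>; for \<open>c = 0\<close> both sides are \<open>ln 0 = 0\<close>.\<close>

lemma ln_divide_mono: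
  fixes a b c :: real
  assumes "0 < a" and "a \<le> b"
  shows "ln (a / c) \<le> ln (b / c)"
  using assms by (simp add: ln_div)

lemma floor_ln_ratio_antimono:
  fixes r c V s t :: real
  assumes "0 < r" and "r < 1" and "0 \<le> V" and "0 < s" and "s \<le> t"
  shows "\<lfloor>ln ((sqrt (t + V\<^sup>2) - V) / c) / ln r\<rfloor> \<le> \<lfloor>ln ((sqrt (s + V\<^sup>2) - V) / c) / ln r\<rfloor>"
proof (intro floor_mono divide_right_mono_neg ln_divide_mono)
  show "0 < sqrt (s + V\<^sup>2) - V" using assms by (intro sqrt_shift_pos)
qed (use assms in auto)

theorem proposition10:
  fixes X :: "(real ^ 'n) set"
    and A Q :: "real ^ 'n ^ 'n"
    and U D :: "complex ^ 'n ^ 'n"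
    and q :: "real ^ 'n"
    and N :: nat
  assumes "polytope X" and "X \<noteq> {}" and "X \<noteq> {0}"
    and "spectral_radius A < 1"
    and "invertible U" and "diagonal_matrix D" and "cmat A = U ** D ** matrix_inv U"
    and "transpose Q = Q"
    and "lambda_max (cmat Q) \<noteq> 0"
    and "pos_semidefinite Q \<or> neg_definite Q"
    and "neg_definite Q \<longrightarrow> q \<noteq> 0"
    and "Inf (enat ` {k. nu X A Q q k > 0}) \<le> enat N"
  shows "\<forall>j\<in>Gamma_set X A Q q. \<forall>k\<in>Gamma_set X A Q q.
           j < k \<longrightarrow> K_diag X A Q q U k \<le> K_diag X A Q q U j"
proof (intro ballI impI)
  fix j k assume "j \<in> Gamma_set X A Q q" and "k \<in> Gamma_set X A Q q" and "j < k"
  then have nu: "0 < nu X A Q q j" "nu X A Q q j \<le> nu X A Q q k"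
    by (auto simp: Gamma_set_def intro: less_imp_le)
  have "eigenvalues (cmat A) = range (\<lambda>i. D $ i $ i)"
    using assms(5-7) by (rule eigenvalues_diagonalization)
  then have "0 \<le> spectral_radius A" by (intro spectral_radius_nonneg) auto
  moreover have "0 \<le> V_diag U Q q" by (simp add: V_diag_def)
  ultimately show "K_diag X A Q q U k \<le> K_diag X A Q q U j"
    using floor_ln_ratio_antimono[OF _ assms(4) _ nu] by (auto simp: K_diag_def)
qed

end
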